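(* There exist infinitely many (pairwise non-isomorphic) multigraphs $G$ with $\chi_c'(G) = 4+\frac{3}{4}$, $\Delta(G)=4$, vertex connectivity $1$ and edge connectivity $2$.
   Context: Multigraphs are finite and loopless; parallel edges are allowed. $\Delta(G)$ denotes the maximum degree of $G$ (parallel edges counted with multiplicity). For a real number $r$, a circular $r$-edge-colouring of $G$ is a map $c$ assigning to each edge of $G$ a real number in $[0,r)$ such that any two distinct edges $e,f$ sharing at least one end-vertex (in particular, any two parallel edges) satisfy $1\le |c(e)-c(f)|\le r-1$. The circular chromatic index $\chi_c'(G)$ is the infimum (attained for finite multigraphs) of all $r$ such that $G$ admits a circular $r$-edge-colouring. *)

theory Defs
  imports Complex_Main
begin

record ('v, 'e) pre_multigraph =
  verts :: "'v set"
  edges :: "'e set"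
  ends  :: "'e \<Rightarrow> 'v set"

text \<open>Looplessness is the requirement that an edge has exactly two end-vertices. Parallel edges
  are distinct elements of \<open>edges G\<close> with the same image under \<open>ends G\<close>.\<close>

locale multigraph =
  fixes G :: "('v, 'e) pre_multigraph"
  assumes finite_verts: "finite (verts G)"
    and finite_edges: "finite (edges G)"
    and ends_subset: "e \<in> edges G \<Longrightarrow> ends G e \<subseteq> verts G"
    and card_ends: "e \<in> edges G \<Longrightarrow> card (ends G e) = 2"

definition isomorphic :: "('v, 'e) pre_multigraph \<Rightarrow> ('w, 'f) pre_multigraph \<Rightarrow> bool" where
  "isomorphic G H \<longleftrightarrow>
     (\<exists>\<phi> \<psi>. bij_betw \<phi> (verts G) (verts H) \<and> bij_betw \<psi> (edges G) (edges H) \<and>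
            (\<forall>e\<in>edges G. ends H (\<psi> e) = \<phi> ` ends G e))"

definition degree :: "('v, 'e) pre_multigraph \<Rightarrow> 'v \<Rightarrow> nat" where
  "degree G v = card {e \<in> edges G. v \<in> ends G e}"

text \<open>Only meaningful if \<open>verts G\<close> is nonempty.\<close>

definition max_degree :: "('v, 'e) pre_multigraph \<Rightarrow> nat" where
  "max_degree G = Max (degree G ` verts G)"

definition adjacency :: "('v, 'e) pre_multigraph \<Rightarrow> ('v \<times> 'v) set" where
  "adjacency G = {(u, v). \<exists>e\<in>edges G. ends G e = {u, v}}"

definition connected_graph :: "('v, 'e) pre_multigraph \<Rightarrow> bool" where
  "connected_graph G \<longleftrightarrow> (\<forall>u\<in>verts G. \<forall>v\<in>verts G. (u, v) \<in> (adjacency G)\<^sup>*)"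

definition delete_verts :: "('v, 'e) pre_multigraph \<Rightarrow> 'v set \<Rightarrow> ('v, 'e) pre_multigraph" where
  "delete_verts G S =
     G\<lparr>verts := verts G - S, edges := {e \<in> edges G. ends G e \<inter> S = {}}\<rparr>"

definition delete_edges :: "('v, 'e) pre_multigraph \<Rightarrow> 'e set \<Rightarrow> ('v, 'e) pre_multigraph" where
  "delete_edges G F = G\<lparr>edges := edges G - F\<rparr>"

text \<open>The alternative of having at most one vertex is the usual convention for graphs in which
  every two vertices are adjacent (no set of vertices separates them) and for graphs with at most
  one vertex (both connectivities are 0).\<close>

definition vertex_connectivity :: "('v, 'e) pre_multigraph \<Rightarrow> nat" where
  "vertex_connectivity G =
     (LEAST k. \<exists>S\<subseteq>verts G. card S = k \<and>
        (\<not> connected_graph (delete_verts G S) \<or> card (verts (delete_verts G S)) \<le> 1))"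

definition edge_connectivity :: "('v, 'e) pre_multigraph \<Rightarrow> nat" where
  "edge_connectivity G =
     (LEAST k. \<exists>F\<subseteq>edges G. card F = k \<and>
        (\<not> connected_graph (delete_edges G F) \<or> card (verts G) \<le> 1))"

definition circular_edge_colouring ::
    "('v, 'e) pre_multigraph \<Rightarrow> real \<Rightarrow> ('e \<Rightarrow> real) \<Rightarrow> bool" where
  "circular_edge_colouring G r c \<longleftrightarrow>
     (\<forall>e\<in>edges G. c e \<in> {0..<r}) \<and>
     (\<forall>e\<in>edges G. \<forall>f\<in>edges G. e \<noteq> f \<and> ends G e \<inter> ends G f \<noteq> {} \<longrightarrow>
        1 \<le> \<bar>c e - c f\<bar> \<and> \<bar>c e - c f\<bar> \<le> r - 1)"

text \<open>Only meaningful if \<open>G\<close> has an edge: otherwise every real \<open>r\<close> admits a colouring, and the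
  set below has no lower bound.\<close>

definition circular_chromatic_index :: "('v, 'e) pre_multigraph \<Rightarrow> real" where
  "circular_chromatic_index G = Inf {r. \<exists>c. circular_edge_colouring G r c}"

end

theory Submission
  imports Defs
begin

text \<open>Let \<open>r = 4 + \<delta>\<close> with \<open>\<delta> < 1\<close> and measure colours on a circle of length \<open>r\<close>. If \<open>u\<close> and \<open>w\<close> are joined by
  a triple edge, then the fourth edge at \<open>u\<close> and the fourth edge at \<open>w\<close> have colours at distance at
  most \<open>\<delta>\<close>: the triple edge is an imprecise wire. If two edges at a vertex of degree 4 have colours at
  distance \<open>d < 2\<close>, the other two do not lie on different sides of them, so their distance is at most
  \<open>2 + \<delta> - d\<close>.

  Take a triangle \<open>v\<^sub>0v\<^sub>1v\<^sub>2\<close>. At each of \<open>v\<^sub>0\<close> and \<open>v\<^sub>1\<close> attach a gadget (two new vertices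
  \<open>u\<close>, \<open>w\<close>, each joined to the triangle vertex, and between them a double edge and a wire) whose two
  edges at the triangle vertex are forced to a distance \<open>d\<close> with \<open>2 - \<delta> \<le> d < 2\<close>; the triangle edges there are then at distance at
  most \<open>2\<delta>\<close>. At \<open>v\<^sub>2\<close> attach a chain of double edges ending in a loop of two wires, which forces only
  \<open>1 \<le> d < 2\<close>; the triangle edges there are at distance at most \<open>1 + \<delta>\<close>. The three triangle
  edges go once round the circle, so \<open>4 + \<delta> \<le> 2\<delta> + 2\<delta> + 1 + \<delta>\<close>, that is \<open>\<delta> \<ge> 3/4\<close>. The length of the
  chain is free. The graphs are 4-regular, so every edge cut has even size.\<close>

section \<open>Points on a circle\<close>

text \<open>In both predicates \<open>r\<close> is the circumference: the distance of \<open>x\<close> and \<open>y\<close> on the circle is at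
  least \<open>s\<close>, respectively at most \<open>t\<close>. This reading needs \<open>\<bar>x - y\<bar> \<le> r\<close>.\<close>

definition sep :: "real \<Rightarrow> real \<Rightarrow> real \<Rightarrow> real \<Rightarrow> bool" where
  "sep r s x y \<longleftrightarrow> s \<le> \<bar>x - y\<bar> \<and> \<bar>x - y\<bar> \<le> r - s"

definition near :: "real \<Rightarrow> real \<Rightarrow> real \<Rightarrow> real \<Rightarrow> bool" where
  "near r t x y \<longleftrightarrow> \<bar>x - y\<bar> \<le> t \<or> r - t \<le> \<bar>x - y\<bar>"

lemma near_mono: "near r s x y \<Longrightarrow> s \<le> t \<Longrightarrow> near r t x y"
  unfolding near_def by linarith

lemma near_trans:
  assumes "near r s x y" "near r t y z" "x \<in> {0..<r}" "y \<in> {0..<r}" "z \<in> {0..<r}"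
  shows "near r (s + t) x z"
  using assms unfolding near_def atLeastLessThan_iff by linarith

text \<open>The colours \<open>a\<close>, \<open>b\<close>, \<open>c\<close> cut the circle into
  three arcs of length at least 1. A fourth colour needs an arc of length at least 2, and for
  \<open>r < 5\<close> at most one exists. Its length is at most \<open>r - 2\<close>, and
  \<open>e\<close>, \<open>f\<close> keep distance 1 from both its ends.\<close>

lemma triple_edge_near:
  assumes "sep r 1 a b" "sep r 1 a c" "sep r 1 b c"
    and "sep r 1 e a" "sep r 1 e b" "sep r 1 e c"
    and "sep r 1 f a" "sep r 1 f b" "sep r 1 f c" and "r < 5"
  shows "near r (r - 4) e f"
  using assms unfolding sep_def near_def abs_if by argo

text \<open>Keeping distance 1 from \<open>p\<close> and \<open>q\<close>, the colours
  \<open>p'\<close> and \<open>q'\<close> avoid the short arc between these, of length below 2. The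
  other arc has length at most \<open>r - s\<close>, and 1 is lost at each end.\<close>

lemma hinge_near:
  assumes "sep r 1 p p'" "sep r 1 p q'" "sep r 1 q p'" "sep r 1 q q'" "sep r 1 p' q'"
    and "sep r s p q" "near r t p q" "t < 2" "r < 5"
  shows "near r (r - 2 - s) p' q'"
  using assms unfolding sep_def near_def abs_if by argo

text \<open>Let \<open>r = 4 + \<delta>\<close>. If both arcs between \<open>a\<close> and
  \<open>b\<close> had length at least 2, the places left in them would form two clusters of length
  at most \<delta> < 1. Then \<open>e\<close>, \<open>x\<close> lie in different clusters, as do
  \<open>f\<close>, \<open>y\<close> and \<open>e\<close>, \<open>f\<close>, hence also
  \<open>x\<close>, \<open>y\<close>, against their nearness. So all four lie in one interval of
  length at most 1 + \<delta>, where up to reflection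
  \<open>f \<ge> y + 1 \<ge> x - \<delta> + 1 \<ge> e + 2 - \<delta>\<close>.\<close>

lemma double_edge_gadget:
  assumes "sep r 1 a b" "sep r 1 e f"
    and "sep r 1 e a" "sep r 1 e b" "sep r 1 e x" "sep r 1 x a" "sep r 1 x b"
    and "sep r 1 f a" "sep r 1 f b" "sep r 1 f y" "sep r 1 y a" "sep r 1 y b"
    and "near r (r - 4) x y" and "r < 5" "\<bar>x - y\<bar> < r"
  shows "sep r (6 - r) e f" and "near r (r - 3) e f"
  using assms unfolding sep_def near_def abs_if by argo+

text \<open>If \<open>4 * r < 19\<close>, all three distances are below 2, so none is the sum of the
  other two, which are at least 1 each. Hence the three short arcs cover the circle.\<close>

lemma triangle_lower_bound:
  assumes "sep r 1 p q" "sep r 1 p s" "sep r 1 q s"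
    and "near r (2 * r - 8) p q" "near r (2 * r - 8) p s" "near r (r - 3) q s"
  shows "19 \<le> 4 * r"
  using assms unfolding sep_def near_def abs_if by argo

section \<open>Multigraphs with even degrees\<close>

lemma not_connectedI:
  assumes "u \<in> verts G" "v \<in> verts G" "u \<in> X" "v \<notin> X"
    and closed: "\<And>e. e \<in> edges G \<Longrightarrow> ends G e \<inter> X \<noteq> {} \<Longrightarrow> ends G e \<subseteq> X"
  shows "\<not> connected_graph G"
proof
  assume "connected_graph G"
  then have "(u, v) \<in> (adjacency G)\<^sup>*"
    using assms by (auto simp: connected_graph_def)
  then have "v \<in> X"
  proof (induction rule: rtrancl_induct)
    case (step y z)
    then obtain e where "e \<in> edges G" "ends G e = {y, z}"
      by (auto simp: adjacency_def)
    with closed[of e] step.IH show ?case by auto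
  qed (use \<open>u \<in> X\<close> in simp)
  with \<open>v \<notin> X\<close> show False by simp
qed

lemma sym_adjacency: "sym (adjacency G)"
  by (auto simp: sym_def adjacency_def insert_commute)

lemma connectedI:
  assumes "\<And>v. v \<in> verts G \<Longrightarrow> (u, v) \<in> (adjacency G)\<^sup>*"
  shows "connected_graph G"
  unfolding connected_graph_def
proof (intro ballI)
  fix v w assume "v \<in> verts G" "w \<in> verts G"
  with assms sym_rtrancl[OF sym_adjacency[of G]] show "(v, w) \<in> (adjacency G)\<^sup>*"
    by (meson rtrancl_trans symD)
qed

text \<open>The handshake lemma restricted to \<open>X\<close>; only edges leaving \<open>X\<close>
  contribute odd summands.\<close>

lemma (in multigraph) sum_degree:
  assumes "X \<subseteq> verts G"
  shows "(\<Sum>v\<in>X. degree G v) = (\<Sum>e\<in>edges G. card (ends G e \<inter> X))"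
proof -
  have "finite X" using assms finite_verts finite_subset by blast
  have count: "card {x \<in> A. P x} = (\<Sum>x\<in>A. if P x then 1 else 0)"
    if "finite A" for A :: "'a set" and P
    by (simp only: card_eq_sum sum.inter_filter[OF that])
  have count_edges: "card {x \<in> A. P x} = (\<Sum>x\<in>A. if P x then 1 else 0)"
    if "finite A" for A :: "'b set" and P
    by (simp only: card_eq_sum sum.inter_filter[OF that])
  have "(\<Sum>v\<in>X. degree G v) = (\<Sum>v\<in>X. \<Sum>e\<in>edges G. if v \<in> ends G e then 1 else 0)"
    by (simp only: degree_def count_edges[OF finite_edges])
  also have "\<dots> = (\<Sum>e\<in>edges G. \<Sum>v\<in>X. if v \<in> ends G e then 1 else 0)"
    by (rule sum.swap)
  also have "\<dots> = (\<Sum>e\<in>edges G. card (ends G e \<inter> X))"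
    by (intro sum.cong refl) (simp only: count[OF \<open>finite X\<close>, symmetric] Int_def conj_commute)
  finally show ?thesis .
qed

text \<open>A bridge would be the only edge with exactly one end in the component \<open>X\<close>
  that it cuts off, which would make the degree sum over \<open>X\<close> odd.\<close>

lemma (in multigraph) connected_delete_edge:
  assumes conn: "connected_graph G" and even: "\<And>v. v \<in> verts G \<Longrightarrow> even (degree G v)"
    and "e \<in> edges G"
  shows "connected_graph (delete_edges G {e})"
proof (rule ccontr)
  let ?A = "adjacency (delete_edges G {e})"
  assume "\<not> connected_graph (delete_edges G {e})"
  then obtain u v where uv: "u \<in> verts G" "v \<in> verts G" "(u, v) \<notin> ?A\<^sup>*"
    by (auto simp: connected_graph_def delete_edges_def)
  define X where "X = {w \<in> verts G. (u, w) \<in> ?A\<^sup>*}"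
  have other: "ends G f \<subseteq> X" if f: "f \<in> edges G" "f \<noteq> e" "ends G f \<inter> X \<noteq> {}" for f
  proof
    fix w assume w: "w \<in> ends G f"
    obtain x where x: "x \<in> ends G f" "x \<in> X" using f by blast
    show "w \<in> X"
    proof (cases "w = x")
      case False
      with x w card_ends[OF f(1)] have "ends G f = {x, w}"
        by (auto simp: card_2_iff)
      then have "(x, w) \<in> ?A"
        using f by (auto simp: adjacency_def delete_edges_def)
      with x(2) have "(u, w) \<in> ?A\<^sup>*"
        unfolding X_def by (blast intro: rtrancl_into_rtrancl)
      with w ends_subset[OF f(1)] show ?thesis
        unfolding X_def by blast
    qed (use x in simp)
  qed
  have "even (\<Sum>f\<in>edges G. card (ends G f \<inter> X))"
    using sum_degree[of X] even by (auto simp: X_def intro!: dvd_sum simp flip: sum_degree)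
  moreover have "even (card (ends G f \<inter> X))" if "f \<in> edges G - {e}" for f
  proof (cases "ends G f \<inter> X = {}")
    case False
    then have "ends G f \<inter> X = ends G f" using other[of f] that by blast
    then show ?thesis using card_ends that by simp
  qed simp
  then have "even (\<Sum>f\<in>edges G - {e}. card (ends G f \<inter> X))"
    by (rule dvd_sum)
  ultimately have "even (card (ends G e \<inter> X))"
    by (simp add: sum.remove[OF finite_edges \<open>e \<in> edges G\<close>])
  moreover have "card (ends G e \<inter> X) \<le> 2"
    using card_ends[OF \<open>e \<in> edges G\<close>] by (metis Int_lower1 card.infinite card_mono zero_neq_numeral)
  moreover have "finite (ends G e)"
    using card_ends[OF \<open>e \<in> edges G\<close>] card.infinite by fastforce
  ultimately have "ends G e \<inter> X = {} \<or> ends G e \<subseteq> X"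
  proof -
    consider "card (ends G e \<inter> X) = 0" | "card (ends G e \<inter> X) = 2"
      using \<open>even (card (ends G e \<inter> X))\<close> \<open>card (ends G e \<inter> X) \<le> 2\<close>
      by (cases "card (ends G e \<inter> X)") (auto simp: le_Suc_eq numeral_2_eq_2)
    then show ?thesis
    proof cases
      case 1
      then show ?thesis using \<open>finite (ends G e)\<close> by simp
    next
      case 2
      then have "ends G e \<inter> X = ends G e"
        using \<open>finite (ends G e)\<close> card_ends[OF \<open>e \<in> edges G\<close>] by (intro card_subset_eq) auto
      then show ?thesis by blast
    qed
  qed
  with other have "\<not> connected_graph G"
    by (intro not_connectedI[of u G v X]) (use uv in \<open>auto simp: X_def\<close>)
  with conn show False by simp
qed

lemma pairwise_insert_ball:
  "pairwise R (insert x S) \<longleftrightarrow> (\<forall>y\<in>S. y \<noteq> x \<longrightarrow> R x y \<and> R y x) \<and> pairwise R S"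
  by (auto simp: pairwise_insert)

lemma (in multigraph) circular_edge_colouring_iff:
  "circular_edge_colouring G r c \<longleftrightarrow>
     (\<forall>e\<in>edges G. c e \<in> {0..<r}) \<and>
     (\<forall>v\<in>verts G. pairwise (\<lambda>e f. sep r 1 (c e) (c f)) {e \<in> edges G. v \<in> ends G e})"
  (is "?L \<longleftrightarrow> ?R")
proof
  assume ?L
  then show ?R unfolding circular_edge_colouring_def pairwise_def sep_def by blast
next
  assume R: ?R
  have "sep r 1 (c e) (c f)"
    if "e \<in> edges G" "f \<in> edges G" "e \<noteq> f" "ends G e \<inter> ends G f \<noteq> {}" for e f
  proof -
    obtain v where "v \<in> ends G e" "v \<in> ends G f" using \<open>ends G e \<inter> ends G f \<noteq> {}\<close> by blast
    moreover have "v \<in> verts G" using \<open>v \<in> ends G e\<close> \<open>e \<in> edges G\<close> ends_subset by blast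
    ultimately show ?thesis using R that by (auto simp: pairwise_def)
  qed
  then show ?L unfolding circular_edge_colouring_def sep_def using R by blast
qed

section \<open>The graphs\<close>

text \<open>Edges 0 to 8 form the gadget at vertex 0, 9 to 17 the gadget at vertex 1, 18 to 24 the
  loop of two wires. Edge 25 is a triangle edge; 26 and 27 tie the loop to the chain.\<close>

definition core_ends :: "(nat \<times> nat) list" where
  "core_ends =
     [(0,2), (0,3), (2,3), (2,3), (2,4), (4,5), (4,5), (4,5), (3,5),
      (1,6), (1,7), (6,7), (6,7), (6,8), (8,9), (8,9), (8,9), (7,9),
      (10,11), (10,11), (10,11), (11,12), (12,13), (12,13), (12,13),
      (0,1), (10,14), (13,14)]"

text \<open>The triangle has vertices \<open>0\<close>, \<open>1\<close> and \<open>14 + n\<close>. The gadgets occupy \<open>2\<close> to \<open>5\<close> and \<open>6\<close> to \<open>9\<close>, the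
  loop of two wires \<open>10\<close> to \<open>13\<close>, and the chain of double edges runs from \<open>14\<close> to \<open>14 + n\<close>. Edges from
  \<open>26\<close> on are numbered so that vertex \<open>14 + i\<close> is incident with \<open>26 + 2i, \<dots>, 29 + 2i\<close> for all
  \<open>i \<le> n\<close>, also at both ends of the chain.\<close>

definition tail_ends :: "nat \<Rightarrow> nat \<Rightarrow> nat \<times> nat" where
  "tail_ends n e =
     (if e < 28 then core_ends ! e
      else if e = 28 + 2 * n then (0, 14 + n)
      else if e = 29 + 2 * n then (1, 14 + n)
      else (e div 2, e div 2 + 1))"

definition tailed_graph :: "nat \<Rightarrow> (nat, nat) pre_multigraph" where
  "tailed_graph n =
     \<lparr>verts = {..<15 + n}, edges = {..<30 + 2 * n},
      ends = (\<lambda>e. {fst (tail_ends n e), snd (tail_ends n e)})\<rparr>"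

lemma tailed_graph_simps [simp]:
  "verts (tailed_graph n) = {..<15 + n}"
  "edges (tailed_graph n) = {..<30 + 2 * n}"
  by (simp_all add: tailed_graph_def)

lemma ends_tailed_graph:
  "ends (tailed_graph n) e = {fst (tail_ends n e), snd (tail_ends n e)}"
  by (simp add: tailed_graph_def)

text \<open>Only edges below 28 are listed, so the entries for vertices 0, 1 and 14 are
  incomplete.\<close>

definition core_incident :: "nat list list" where
  "core_incident =
     [[0,1,25], [9,10,25], [0,2,3,4], [1,2,3,8], [4,5,6,7], [5,6,7,8],
      [9,11,12,13], [10,11,12,17], [13,14,15,16], [14,15,16,17],
      [18,19,20,26], [18,19,20,21], [21,22,23,24], [22,23,24,27], [26,27]]"

definition incident :: "nat \<Rightarrow> nat \<Rightarrow> nat set" where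
  "incident n v =
     (if v < 14 then set (core_incident ! v) \<union>
        (if v = 0 then {28 + 2 * n} else if v = 1 then {29 + 2 * n} else {})
      else {2 * v - 2, 2 * v - 1, 2 * v, 2 * v + 1})"

lemma core_ends_less:
  assumes "e < 28"
  shows "fst (core_ends ! e) < snd (core_ends ! e)" and "snd (core_ends ! e) < 15"
proof -
  have "\<forall>e\<in>set [0..<28]. fst (core_ends ! e) < snd (core_ends ! e) \<and> snd (core_ends ! e) < 15"
    by code_simp
  with assms show "fst (core_ends ! e) < snd (core_ends ! e)" "snd (core_ends ! e) < 15" by simp_all
qed

lemma core_incident_iff:
  assumes "e < 28" "v < 15"
  shows "v \<in> {fst (core_ends ! e), snd (core_ends ! e)} \<longleftrightarrow> e \<in> set (core_incident ! v)"
proof -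
  have "\<forall>e\<in>set [0..<28]. \<forall>v\<in>set [0..<15].
      (v = fst (core_ends ! e) \<or> v = snd (core_ends ! e)) = (e \<in> set (core_incident ! v))"
    by code_simp
  with assms show ?thesis by simp
qed

lemma core_incident_less:
  assumes "v < 15" "e \<in> set (core_incident ! v)"
  shows "e < 28"
proof -
  have "\<forall>v\<in>set [0..<15]. \<forall>e\<in>set (core_incident ! v). e < 28"
    by code_simp
  with assms show ?thesis by simp
qed

lemma tail_ends_less:
  assumes "e < 30 + 2 * n"
  shows "fst (tail_ends n e) < snd (tail_ends n e)" and "snd (tail_ends n e) < 15 + n"
  using assms core_ends_less[of e] by (auto simp: tail_ends_def)

lemma multigraph_tailed_graph: "multigraph (tailed_graph n)"
proof
  fix e assume "e \<in> edges (tailed_graph n)"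
  then have "fst (tail_ends n e) < snd (tail_ends n e)" "snd (tail_ends n e) < 15 + n"
    using tail_ends_less by (auto simp: ends_tailed_graph)
  then show "ends (tailed_graph n) e \<subseteq> verts (tailed_graph n)" "card (ends (tailed_graph n) e) = 2"
    by (auto simp: ends_tailed_graph)
qed (simp_all add: ends_tailed_graph)

lemma incident_edges:
  assumes "v < 15 + (n::nat)"
  shows "{e. e < 30 + 2 * n \<and> v \<in> ends (tailed_graph n) e} = incident n v"
proof -
  have "e < 30 + 2 * n \<and> v \<in> {fst (tail_ends n e), snd (tail_ends n e)} \<longleftrightarrow> e \<in> incident n v" for e
  proof (cases "e < 28")
    case True
    have "core_incident ! 14 = [26, 27]" by code_simp
    then show ?thesis
      using True core_incident_iff[of e v] core_ends_less[of e]
      by (cases "v < 14"; cases "v = 14") (auto simp: tail_ends_def incident_def)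
  next
    case False
    then show ?thesis
      using assms core_incident_less[of v e] by (auto simp: tail_ends_def incident_def split: if_splits)
  qed
  then show ?thesis by (auto simp: ends_tailed_graph)
qed

lemma incident_simps:
  "incident n 0 = {28 + 2 * n, 0, 1, 25}"
  "incident n 1 = {29 + 2 * n, 9, 10, 25}"
  "incident n 2 = {0, 2, 3, 4}"
  "incident n 3 = {1, 2, 3, 8}"
  "incident n 4 = {4, 5, 6, 7}"
  "incident n 5 = {5, 6, 7, 8}"
  "incident n 6 = {9, 11, 12, 13}"
  "incident n 7 = {10, 11, 12, 17}"
  "incident n 8 = {13, 14, 15, 16}"
  "incident n 9 = {14, 15, 16, 17}"
  "incident n 10 = {18, 19, 20, 26}"
  "incident n 11 = {18, 19, 20, 21}"
  "incident n 12 = {21, 22, 23, 24}"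
  "incident n 13 = {22, 23, 24, 27}"
  by (simp_all add: incident_def core_incident_def)

lemma incident_tail:
  "incident n (14 + i) = {26 + 2 * i, 27 + 2 * i, 28 + 2 * i, 29 + 2 * i}"
proof -
  have "2 * (14 + i) - 2 = 26 + 2 * i" "2 * (14 + i) - 1 = 27 + 2 * i"
    "2 * (14 + i) = 28 + 2 * i" "2 * (14 + i) + 1 = 29 + 2 * i" by simp_all
  then show ?thesis unfolding incident_def by simp
qed

lemma vertex_cases:
  assumes "v < 15 + (n::nat)"
  obtains "v = 0" | "v = 1" | "v = 2" | "v = 3" | "v = 4" | "v = 5" | "v = 6" | "v = 7"
    | "v = 8" | "v = 9" | "v = 10" | "v = 11" | "v = 12" | "v = 13" | i where "v = 14 + i" "i \<le> n"
proof (cases "v < 14")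
  case False
  with assms that(15)[of "v - 14"] show ?thesis by simp
next
  case True
  then have "v = 0 \<or> v = 1 \<or> v = 2 \<or> v = 3 \<or> v = 4 \<or> v = 5 \<or> v = 6 \<or> v = 7
      \<or> v = 8 \<or> v = 9 \<or> v = 10 \<or> v = 11 \<or> v = 12 \<or> v = 13"
    by arith
  then show ?thesis by (elim disjE) (erule that)+
qed

lemma degree_tailed_graph:
  assumes "v \<in> verts (tailed_graph n)"
  shows "degree (tailed_graph n) v = 4"
proof -
  have v: "v < 15 + n" using assms by (simp add: ends_tailed_graph)
  then have "degree (tailed_graph n) v = card (incident n v)"
    by (simp add: degree_def incident_edges)
  also from v have "\<dots> = 4"
    by (cases rule: vertex_cases) (simp_all only: incident_simps incident_tail, simp_all)
  finally show ?thesis .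
qed

lemma max_degree_tailed_graph: "max_degree (tailed_graph n) = 4"
proof -
  have "degree (tailed_graph n) ` verts (tailed_graph n) = (\<lambda>_. 4) ` verts (tailed_graph n)"
    by (intro image_cong refl degree_tailed_graph)
  also have "\<dots> = {4}" by (simp add: ends_tailed_graph image_constant_conv lessThan_empty_iff)
  finally show ?thesis by (simp add: max_degree_def)
qed

section \<open>Connectivity\<close>

lemma tailed_graph_adjacent:
  assumes "e < 30 + 2 * n" "tail_ends n e = (u, v)"
  shows "(u, v) \<in> adjacency (tailed_graph n)" "(v, u) \<in> adjacency (tailed_graph n)"
  using assms by (auto simp: adjacency_def ends_tailed_graph intro!: bexI[of _ e])

lemma connected_tailed_graph: "connected_graph (tailed_graph n)"
proof (rule connectedI[of _ 0])
  let ?R = "\<lambda>v. (0, v) \<in> (adjacency (tailed_graph n))\<^sup>*"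
  have core: "?R u \<Longrightarrow> ?R v" "?R v \<Longrightarrow> ?R u" if "e < 28" "core_ends ! e = (u, v)" for e u v
    using that tailed_graph_adjacent[of e n u v]
    by (auto simp: tail_ends_def intro: rtrancl_into_rtrancl)
  have 0: "?R 0" by simp
  have 2: "?R 2" using core(1)[of 0 0 2] by (simp add: core_ends_def)
  have 3: "?R 3" using core(1)[of 1 0 3] by (simp add: core_ends_def)
  have 4: "?R 4" using core(1)[of 4 2 4] 2 by (simp add: core_ends_def)
  have 5: "?R 5" using core(1)[of 8 3 5] 3 by (simp add: core_ends_def)
  have 1: "?R 1" using core(1)[of 25 0 1] by (simp add: core_ends_def)
  have 6: "?R 6" using core(1)[of 9 1 6] 1 by (simp add: core_ends_def)
  have 7: "?R 7" using core(1)[of 10 1 7] 1 by (simp add: core_ends_def)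
  have 8: "?R 8" using core(1)[of 13 6 8] 6 by (simp add: core_ends_def)
  have 9: "?R 9" using core(1)[of 17 7 9] 7 by (simp add: core_ends_def)
  have tail: "?R (14 + i)" if "i \<le> n" for i
    using that
  \<comment> \<open>The chain is entered at its far end \<open>14 + n\<close>, a neighbour of
    \<open>0\<close>, and followed downwards.\<close>
  proof (induction i rule: inc_induct)
    case base
    show ?case
      using tailed_graph_adjacent(1)[of "28 + 2 * n" n 0 "14 + n"]
      by (auto simp: tail_ends_def)
  next
    case (step i)
    then have "(14 + Suc i, 14 + i) \<in> adjacency (tailed_graph n)"
      by (intro tailed_graph_adjacent(2)[of "28 + 2 * i"]) (auto simp: tail_ends_def)
    with step.IH show ?case by (rule rtrancl_into_rtrancl)
  qed
  have 10: "?R 10" using core(2)[of 26 10 14] tail[of 0] by (simp add: core_ends_def)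
  have 11: "?R 11" using core(1)[of 18 10 11] 10 by (simp add: core_ends_def)
  have 12: "?R 12" using core(1)[of 21 11 12] 11 by (simp add: core_ends_def)
  have 13: "?R 13" using core(1)[of 22 12 13] 12 by (simp add: core_ends_def)
  fix v assume "v \<in> verts (tailed_graph n)"
  then have "v < 15 + n" by (simp add: ends_tailed_graph)
  then show "?R v"
    by (cases rule: vertex_cases) (use 0 1 2 3 4 5 6 7 8 9 10 11 12 13 tail in simp_all)
qed

text \<open>Edges 26 and 27 both meet vertex 14, so this yields the cut vertex 14 as well as the
  edge cut of size 2.\<close>

lemma loop_ends:
  assumes "ends (tailed_graph n) e \<inter> {10, 11, 12, 13} \<noteq> {}"
  shows "ends (tailed_graph n) e \<subseteq> {10, 11, 12, 13} \<or> e \<in> {26, 27}"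
proof -
  define X where "X = {10, 11, 12, 13 :: nat}"
  have "(fst (tail_ends n e) \<in> X \<or> snd (tail_ends n e) \<in> X) \<longrightarrow>
      (fst (tail_ends n e) \<in> X \<and> snd (tail_ends n e) \<in> X) \<or> e \<in> {26, 27}"
  proof (cases "e < 28")
    case True
    have "\<forall>e\<in>set [0..<28]. (fst (core_ends ! e) \<in> X \<or> snd (core_ends ! e) \<in> X) \<longrightarrow>
        (fst (core_ends ! e) \<in> X \<and> snd (core_ends ! e) \<in> X) \<or> e \<in> {26, 27}"
      unfolding X_def by code_simp
    with True show ?thesis by (simp add: tail_ends_def)
  next
    case False
    then have "e div 2 \<ge> 14" using div_le_mono[of 28 e 2] by simp
    then show ?thesis using False by (simp add: tail_ends_def X_def)
  qed
  moreover have "{fst (tail_ends n e), snd (tail_ends n e)} \<inter> X \<noteq> {}"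
    using assms unfolding ends_tailed_graph X_def .
  ultimately show ?thesis
    unfolding ends_tailed_graph X_def[symmetric] by blast
qed

lemma ends_26_27: "ends (tailed_graph n) 26 = {10, 14}" "ends (tailed_graph n) 27 = {13, 14}"
  by (auto simp: ends_tailed_graph tail_ends_def core_ends_def)

lemma vertex_connectivity_tailed_graph: "vertex_connectivity (tailed_graph n) = 1"
  unfolding vertex_connectivity_def
proof (rule Least_equality)
  let ?G = "tailed_graph n"
  have "\<not> connected_graph (delete_verts ?G {14})"
  proof (rule not_connectedI[of 10 _ 0 "{10, 11, 12, 13}"])
    fix e assume "e \<in> edges (delete_verts ?G {14})"
      and "ends (delete_verts ?G {14}) e \<inter> {10, 11, 12, 13} \<noteq> {}"
    then show "ends (delete_verts ?G {14}) e \<subseteq> {10, 11, 12, 13}"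
      using loop_ends[of n e] ends_26_27[of n]
      by (auto simp: delete_verts_def ends_tailed_graph)
  qed (auto simp: delete_verts_def ends_tailed_graph)
  then show "\<exists>S\<subseteq>verts ?G. card S = 1 \<and>
      (\<not> connected_graph (delete_verts ?G S) \<or> card (verts (delete_verts ?G S)) \<le> 1)"
    by (intro exI[of _ "{14}"]) (simp add: ends_tailed_graph)
next
  let ?G = "tailed_graph n"
  fix k assume "\<exists>S\<subseteq>verts ?G. card S = k \<and>
      (\<not> connected_graph (delete_verts ?G S) \<or> card (verts (delete_verts ?G S)) \<le> 1)"
  then obtain S where S: "S \<subseteq> verts ?G" "card S = k"
    "\<not> connected_graph (delete_verts ?G S) \<or> card (verts (delete_verts ?G S)) \<le> 1" by blast
  have "delete_verts G {} = G" for G :: "(nat, nat) pre_multigraph" by (simp add: delete_verts_def)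
  then have "S \<noteq> {}"
    using S(3) connected_tailed_graph[of n] by (auto simp: ends_tailed_graph)
  moreover have "finite S"
    using S(1) finite_subset by (fastforce simp: ends_tailed_graph)
  ultimately show "1 \<le> k"
    using S(2) by (metis One_nat_def Suc_leI card_gt_0_iff)
qed

lemma edge_connectivity_tailed_graph: "edge_connectivity (tailed_graph n) = 2"
  unfolding edge_connectivity_def
proof (rule Least_equality)
  let ?G = "tailed_graph n"
  have "\<not> connected_graph (delete_edges ?G {26, 27})"
  proof (rule not_connectedI[of 10 _ 0 "{10, 11, 12, 13}"])
    fix e assume "e \<in> edges (delete_edges ?G {26, 27})"
      and "ends (delete_edges ?G {26, 27}) e \<inter> {10, 11, 12, 13} \<noteq> {}"
    then show "ends (delete_edges ?G {26, 27}) e \<subseteq> {10, 11, 12, 13}"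
      using loop_ends[of n e] by (auto simp: delete_edges_def ends_tailed_graph)
  qed (auto simp: delete_edges_def ends_tailed_graph)
  then show "\<exists>F\<subseteq>edges ?G. card F = 2 \<and>
      (\<not> connected_graph (delete_edges ?G F) \<or> card (verts ?G) \<le> 1)"
    by (intro exI[of _ "{26, 27}"]) (simp add: ends_tailed_graph)
next
  let ?G = "tailed_graph n"
  fix k assume "\<exists>F\<subseteq>edges ?G. card F = k \<and>
      (\<not> connected_graph (delete_edges ?G F) \<or> card (verts ?G) \<le> 1)"
  then obtain F where F: "F \<subseteq> edges ?G" "card F = k" "\<not> connected_graph (delete_edges ?G F)"
    by (auto simp: ends_tailed_graph)
  interpret multigraph ?G by (rule multigraph_tailed_graph)
  have "delete_edges ?G {} = ?G" by (simp add: delete_edges_def)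
  then have "F \<noteq> {}" using F(3) connected_tailed_graph[of n] by auto
  moreover have "F \<noteq> {e}" for e
    using F connected_delete_edge[OF connected_tailed_graph, of e] degree_tailed_graph by auto
  moreover have "finite F" using F(1) finite_edges finite_subset by blast
  ultimately have "card F \<noteq> 0" "card F \<noteq> 1"
    by (auto simp: card_1_singleton_iff)
  with F(2) show "2 \<le> k" by simp
qed

section \<open>The circular chromatic index\<close>

text \<open>Colours are in units of \<open>1/4\<close>, on a circle of length \<open>19\<close>. The double edges of the chain are
  coloured alternately \<open>12, 16\<close> and \<open>4, 8\<close>, starting from \<open>4, 8\<close> on the loop edges; for even \<open>n\<close> this
  fits the colours \<open>12, 0\<close> of the triangle edges at \<open>14 + n\<close>.\<close>

definition core_colours :: "nat list" where
  "core_colours =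
     [16, 2, 12, 8, 1, 5, 9, 13, 17,
      10, 15, 6, 2, 14, 18, 3, 7, 11,
      10, 14, 18, 6, 12, 16, 1, 6]"

text \<open>From edge 26 on the formula cycles through 4, 8, 12, 16. For even \<open>n\<close> the
  exceptional 0 replaces a 16: the triangle colours 6, 12, 0 then have distances 6, 6, 7, which are
  the extremal 2\<delta>, 2\<delta>, 1 + \<delta> at \<delta> = 3/4.\<close>

definition tail_colour :: "nat \<Rightarrow> nat \<Rightarrow> nat" where
  "tail_colour n e =
     (if e < 26 then core_colours ! e
      else if e = 29 + 2 * n then 0
      else 4 * ((e + 2) mod 4 + 1))"

lemma tail_colour_less:
  assumes "e < 30 + 2 * n"
  shows "tail_colour n e < 19"
proof -
  have "\<forall>e\<in>set [0..<26]. core_colours ! e < 19" by code_simp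
  moreover have "m < 4 \<Longrightarrow> 4 * (m + 1) < 19" for m :: nat by simp
  then have "4 * ((e + 2) mod 4 + 1) < 19" by simp
  ultimately show ?thesis by (auto simp: tail_colour_def)
qed

lemma tail_colour_core:
  "tail_colour n 0 = 16" "tail_colour n 1 = 2" "tail_colour n 2 = 12" "tail_colour n 3 = 8"
  "tail_colour n 4 = 1" "tail_colour n 5 = 5" "tail_colour n 6 = 9" "tail_colour n 7 = 13"
  "tail_colour n 8 = 17" "tail_colour n 9 = 10" "tail_colour n 10 = 15" "tail_colour n 11 = 6"
  "tail_colour n 12 = 2" "tail_colour n 13 = 14" "tail_colour n 14 = 18" "tail_colour n 15 = 3"
  "tail_colour n 16 = 7" "tail_colour n 17 = 11" "tail_colour n 18 = 10" "tail_colour n 19 = 14"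
  "tail_colour n 20 = 18" "tail_colour n 21 = 6" "tail_colour n 22 = 12" "tail_colour n 23 = 16"
  "tail_colour n 24 = 1" "tail_colour n 25 = 6" "tail_colour n 26 = 4" "tail_colour n 27 = 8"
  by (simp_all add: tail_colour_def core_colours_def)

lemma tail_colour_even:
  assumes "even n" "i \<le> n"
  shows "tail_colour n (26 + 2 * i) = (if even i then 4 else 12)"
    and "tail_colour n (27 + 2 * i) = (if even i then 8 else 16)"
    and "tail_colour n (28 + 2 * i) = (if even i then 12 else 4)"
    and "tail_colour n (29 + 2 * i) = (if i = n then 0 else if even i then 16 else 8)"
  using assms by (auto simp: tail_colour_def elim!: evenE oddE)

lemma circular_edge_colouring_tailed_graph:
  assumes "even n"
  shows "circular_edge_colouring (tailed_graph n) (19 / 4) (\<lambda>e. real (tail_colour n e) / 4)"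
proof -
  interpret multigraph "tailed_graph n" by (rule multigraph_tailed_graph)
  have "pairwise (\<lambda>e f. sep (19 / 4) 1 (real (tail_colour n e) / 4) (real (tail_colour n f) / 4))
      (incident n v)" if v: "v < 15 + n" for v
  proof -
    have 28: "tail_colour n (28 + 2 * n) = 12" and 29: "tail_colour n (29 + 2 * n) = 0"
      using tail_colour_even[OF assms order_refl] assms by auto
    have last: "(i = n) \<Longrightarrow> even i" for i using assms by simp
    from v show ?thesis
    proof (cases rule: vertex_cases)
      case (15 i)
      then show ?thesis
        using tail_colour_even[OF assms \<open>i \<le> n\<close>] last[of i]
        by (simp only: incident_tail) (auto simp: pairwise_insert_ball sep_def)
    qed (simp only: incident_simps,
        simp add: pairwise_insert_ball sep_def 28 29 tail_colour_core tail_colour_core(2)[simplified])+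
  qed
  then show ?thesis
    unfolding circular_edge_colouring_iff
    using tail_colour_less[of _ n] incident_edges[of _ n]
    by (auto simp: ends_tailed_graph)
qed

lemma circular_edge_colouring_lower_bound:
  assumes col: "circular_edge_colouring (tailed_graph n) r c"
  shows "19 / 4 \<le> r"
proof (rule ccontr)
  assume "\<not> 19 / 4 \<le> r"
  then have r: "4 * r < 19" by simp
  interpret multigraph "tailed_graph n" by (rule multigraph_tailed_graph)
  have range: "c e \<in> {0..<r}" if "e < 30 + 2 * n" for e
    using col that by (simp add: circular_edge_colouring_iff ends_tailed_graph)
  have P: "pairwise (\<lambda>e f. sep r 1 (c e) (c f)) (incident n v)" if "v < 15 + n" for v
    using col that by (simp add: circular_edge_colouring_iff incident_edges)
  note core = P[of 0] P[of 1] P[of 2] P[of 3] P[of 4] P[of 5] P[of 6] P[of 7] P[of 8] P[of 9]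
    P[of 10] P[of 11] P[of 12] P[of 13]
  note at = core[unfolded incident_simps pairwise_insert_ball, simplified]
  have at_tail: "sep r 1 (c (26 + 2 * i)) (c (27 + 2 * i))" "sep r 1 (c (26 + 2 * i)) (c (28 + 2 * i))"
    "sep r 1 (c (26 + 2 * i)) (c (29 + 2 * i))" "sep r 1 (c (27 + 2 * i)) (c (28 + 2 * i))"
    "sep r 1 (c (27 + 2 * i)) (c (29 + 2 * i))" "sep r 1 (c (28 + 2 * i)) (c (29 + 2 * i))"
    if "i \<le> n" for i
    using P[of "14 + i"] that by (simp_all only: incident_tail) (simp_all add: pairwise_insert_ball)

  have "near r (r - 4) (c 4) (c 8)"
    using r by (intro triple_edge_near[of r "c 5" "c 6" "c 7"]) (simp_all add: at)
  then have "sep r (6 - r) (c 0) (c 1)" "near r (r - 3) (c 0) (c 1)"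
    using r range[of 4] range[of 8]
    by (intro double_edge_gadget[of r "c 2" "c 3" _ _ "c 4" "c 8"]; simp add: at abs_if)+
  then have "near r (r - 2 - (6 - r)) (c 25) (c (28 + 2 * n))"
    using r by (intro hinge_near[of r "c 0" _ _ "c 1" _ "r - 3"]) (simp_all add: at)
  then have hinge0: "near r (2 * r - 8) (c 25) (c (28 + 2 * n))" by simp

  have "near r (r - 4) (c 13) (c 17)"
    using r by (intro triple_edge_near[of r "c 14" "c 15" "c 16"]) (simp_all add: at)
  then have "sep r (6 - r) (c 9) (c 10)" "near r (r - 3) (c 9) (c 10)"
    using r range[of 13] range[of 17]
    by (intro double_edge_gadget[of r "c 11" "c 12" _ _ "c 13" "c 17"]; simp add: at abs_if)+
  then have "near r (r - 2 - (6 - r)) (c 25) (c (29 + 2 * n))"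
    using r by (intro hinge_near[of r "c 9" _ _ "c 10" _ "r - 3"]) (simp_all add: at)
  then have hinge1: "near r (2 * r - 8) (c 25) (c (29 + 2 * n))" by simp

  have "near r (r - 4) (c 26) (c 21)"
    using r by (intro triple_edge_near[of r "c 18" "c 19" "c 20"]) (simp_all add: at)
  moreover have "near r (r - 4) (c 21) (c 27)"
    using r by (intro triple_edge_near[of r "c 22" "c 23" "c 24"]) (simp_all add: at)
  ultimately have "near r (r - 4 + (r - 4)) (c 26) (c 27)"
    by (rule near_trans) (use range in simp_all)
  \<comment> \<open>The bound \<open>7 / 4\<close> is an invariant along the chain: it exceeds both
    \<open>2 * r - 8\<close>, which the two wires give, and \<open>r - 3\<close>, which each hinge
    returns, and it stays below 2, as \<open>hinge_near\<close> demands.\<close>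
  then have loop: "near r (7 / 4) (c 26) (c 27)"
    by (rule near_mono) (use r in simp)
  have step: "near r (r - 3) (c (28 + 2 * i)) (c (29 + 2 * i))"
    if "near r (7 / 4) (c (26 + 2 * i)) (c (27 + 2 * i))" "i \<le> n" for i
    using hinge_near[of r "c (26 + 2 * i)" "c (28 + 2 * i)" "c (29 + 2 * i)" "c (27 + 2 * i)" 1 "7 / 4"]
      that r at_tail[of i] by simp
  have "near r (7 / 4) (c (26 + 2 * i)) (c (27 + 2 * i))" if "i \<le> n" for i
    using that
  proof (induction i)
    case (Suc i)
    then have "near r (r - 3) (c (28 + 2 * i)) (c (29 + 2 * i))" by (intro step) simp_all
    moreover have "26 + 2 * Suc i = 28 + 2 * i" "27 + 2 * Suc i = 29 + 2 * i" by simp_all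
    ultimately show ?case using r by (simp only:) (rule near_mono, assumption, linarith)
  qed (use loop in simp)
  then have "near r (r - 3) (c (28 + 2 * n)) (c (29 + 2 * n))"
    by (intro step) simp_all
  with hinge0 hinge1 have "19 \<le> 4 * r"
    by (intro triangle_lower_bound[of r "c 25" "c (28 + 2 * n)" "c (29 + 2 * n)"])
      (simp_all add: at at_tail)
  with r show False by simp
qed

lemma circular_chromatic_index_tailed_graph:
  assumes "even n"
  shows "circular_chromatic_index (tailed_graph n) = 4 + 3 / 4"
proof -
  have "Inf {r. \<exists>c. circular_edge_colouring (tailed_graph n) r c} = 19 / 4"
    using circular_edge_colouring_tailed_graph[OF assms] circular_edge_colouring_lower_bound
    by (intro cInf_eq_minimum) blast+
  then show ?thesis by (simp add: circular_chromatic_index_def)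
qed

lemma isomorphic_tailed_graphD:
  assumes "isomorphic (tailed_graph m) (tailed_graph n)"
  shows "m = n"
proof -
  from assms obtain \<phi> where "bij_betw \<phi> (verts (tailed_graph m)) (verts (tailed_graph n))"
    by (auto simp: isomorphic_def)
  then show ?thesis by (auto dest: bij_betw_same_card)
qed

theorem theorem7:
  "\<exists>\<G> :: (nat, nat) pre_multigraph set.
     infinite \<G> \<and>
     (\<forall>G\<in>\<G>. \<forall>H\<in>\<G>. G \<noteq> H \<longrightarrow> \<not> isomorphic G H) \<and>
     (\<forall>G\<in>\<G>. multigraph G \<and>
        circular_chromatic_index G = 4 + 3 / 4 \<and>
        max_degree G = 4 \<and>
        vertex_connectivity G = 1 \<and>
        edge_connectivity G = 2)"
proof (intro exI[of _ "range (\<lambda>k. tailed_graph (2 * k))"] conjI)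
  \<comment> \<open>The family takes even parameters because the colouring with
    \<open>r = 19 / 4\<close> is constructed for these; the lower bound holds for every
    \<open>n\<close>.\<close>
  have "inj (\<lambda>k. tailed_graph (2 * k))"
    by (rule injI) (auto dest: arg_cong[of _ _ verts])
  then show "infinite (range (\<lambda>k. tailed_graph (2 * k)))"
    using finite_imageD infinite_UNIV_nat by blast
qed (auto dest: isomorphic_tailed_graphD simp: multigraph_tailed_graph max_degree_tailed_graph
    circular_chromatic_index_tailed_graph vertex_connectivity_tailed_graph
    edge_connectivity_tailed_graph)

end
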